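(* Let $\{\omega_n\}_{n\ge 0}$ be the coefficients of the power series $$\epsilon_0\,\hat\chi\Big(\tfrac{2(1-\xi)}{\tau(1+\xi)}\Big) = \sum_{n=0}^\infty \omega_n \xi^n .$$ Consider the following two schemes, with the same initial value $\mathbf{h}^{-1/2}$ and with $\mathbf{e}^0=0$. (A) Difference scheme: with $\mathbf{p}_i^0=0$ for all $i\ge1$, for all integers $n\ge 0$, \begin{align*} \mathsf{M_h}\, d_\tau \mathbf{h}^{n} + \mathsf{C}\,\mathbf{e}^{n} &= 0,\\ \mathsf{M_e}\, d_\tau \mathbf{e}^{n+1/2} + \sum_i d_\tau \mathbf{p}_i^{n+1/2} - \mathsf{C}^{\mathsf{T}}\,\mathbf{h}^{n+1/2} &= 0,\\ \mathsf{M_{d,i}}\, d_\tau \mathbf{p}_i^{n+1/2} + \mathsf{M_{p,i}}\,\overline{\mathbf{p}}_i^{\,n+1/2} &= \overline{\mathbf{e}}^{\,n+1/2}, \qquad i\ge 1, \end{align*} and $\mathbf{p}^n := \sum_i \mathbf{p}_i^n$. (B) Convolution quadrature method: for all integers $n\ge 0$, \begin{align*} \mathsf{M_h}\, d_\tau \mathbf{h}^{n} + \mathsf{C}\,\mathbf{e}^{n} &= 0,\\ \mathsf{M_e}\, d_\tau \mathbf{e}^{n+1/2} + d_\tau \mathbf{p}^{n+1/2} - \mathsf{C}^{\mathsf{T}}\,\mathbf{h}^{n+1/2} &= 0,\\ \mathbf{p}^n &= \sum_{k=0}^n \omega_{n-k}\,\mathbf{e}^k . \end{align*} Then the solution $\{\mathbf{h}^{n+1/2},\mathbf{e}^n,\mathbf{p}^n\}_{n\ge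 0}$ of scheme (A) coincides with the solution of method (B).
   Context: Setting: discretizations of Maxwell's equations in a multipole Debye medium. Here $\tau>0$ is the time step size, $\epsilon_0>0$ is the vacuum permittivity, and the susceptibility is $$\hat\chi(s)=\sum_i \hat\chi_i(s),\qquad \hat\chi_i(s)=\frac{\epsilon_{i,s}-\epsilon_{i,\infty}'}{1+s\tau_i},$$ with real relaxation times $\tau_i>0$ and real constants satisfying $\epsilon_{i,s}-\epsilon_{i,\infty}'>0$. The index $i\ge1$ ranges over a finite or countably infinite set; if it is infinite, it is assumed that $\sum_i(\epsilon_{i,s}-\epsilon_{i,\infty}')<\infty$. The vectors $\mathbf{h}^{n+1/2}$ (magnetic field), $\mathbf{e}^n$ (electric field), $\mathbf{p}_i^n$ and $\mathbf{p}^n$ (polarizations) are real finite-dimensional vectors, where $\mathbf{e}^n,\mathbf{p}_i^n,\mathbf{p}^n$ lie in the same space. $\mathsf{C}$ is a real (possibly rectangular) matrix and $\mathsf{M_h}$, $\mathsf{M_e}$ are real symmetric positive-definite matrices of compatible dimensions. The third equation of scheme (A) is the discretization of the Debye equation $\tau_i\partial_t \mathbf{p}_i+\mathbf{p}_i=\epsilon_0(\epsilon_{i,s}-\epsilon_{i,\infty}')\mathbf{e}$ divided by $\epsilon_0(\epsilon_{i,s}-\epsilon_{i,\infty}')$, i.e. $$\mathsf{M_{d,i}}=\frac{\tau_i}{\epsilon_0(\epsilon_{i,s}-\epsilon_{i,\infty}')}\,\mathsf{I},\qquad \mathsf{M_{p,i}}=\frac{1}{\epsilon_0(\epsilon_{i,s}-\epsilon_{i,\infty}')}\,\mathsf{I},$$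 with $\mathsf{I}$ the identity matrix. Notation: for a quantity $u$ indexed by integers or half-integers, $d_\tau u^{s} = \frac1\tau (u^{s+1/2}-u^{s-1/2})$ and $\overline u^{\,s} = \frac12 (u^{s+1/2}+u^{s-1/2})$. *)

theory Defs
  imports "HOL-Analysis.Analysis"
begin

definition sym_pos_def :: "real^'k^'k \<Rightarrow> bool" where
  "sym_pos_def A \<longleftrightarrow> transpose A = A \<and> (\<forall>x. x \<noteq> 0 \<longrightarrow> x \<bullet> (A *v x) > 0)"

text \<open>
  Susceptibility of a multipole Debye medium with poles indexed by \<open>I\<close>; \<open>\<epsilon>s i\<close> and \<open>\<epsilon>inf i\<close> are the
  static value and the high-frequency value belonging to pole \<open>i\<close>, and \<open>tr i\<close> is its relaxation time.
\<close>

definition debye_pole ::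
    "(nat \<Rightarrow> real) \<Rightarrow> (nat \<Rightarrow> real) \<Rightarrow> (nat \<Rightarrow> real) \<Rightarrow> nat \<Rightarrow> complex \<Rightarrow> complex" where
  "debye_pole \<epsilon>s \<epsilon>inf tr i s = of_real (\<epsilon>s i - \<epsilon>inf i) / (1 + s * of_real (tr i))"

definition debye_chi ::
    "nat set \<Rightarrow> (nat \<Rightarrow> real) \<Rightarrow> (nat \<Rightarrow> real) \<Rightarrow> (nat \<Rightarrow> real) \<Rightarrow> complex \<Rightarrow> complex" where
  "debye_chi I \<epsilon>s \<epsilon>inf tr s = (\<Sum>\<^sub>\<infinity>i\<in>I. debye_pole \<epsilon>s \<epsilon>inf tr i s)"

text \<open>
  Time grids are indexed by natural numbers. For the integer-grid quantities, \<open>e n\<close>, \<open>pp i n\<close> and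
  \<open>p n\<close> are the values at time level \<open>n\<close>. For the staggered magnetic field, \<open>h n\<close> is the value at
  level \<open>n - 1/2\<close>, so that \<open>h 0\<close> is the initial value at level \<open>-1/2\<close>. Accordingly \<open>dtau \<tau> e n\<close> and
  \<open>avg e n\<close> are centred at \<open>n + 1/2\<close>, whereas \<open>dtau \<tau> h n\<close> is centred at \<open>n\<close>.
\<close>

definition dtau :: "real \<Rightarrow> (nat \<Rightarrow> 'v::real_vector) \<Rightarrow> nat \<Rightarrow> 'v" where
  "dtau \<tau> u n = (1 / \<tau>) *\<^sub>R (u (Suc n) - u n)"

definition avg :: "(nat \<Rightarrow> 'v::real_vector) \<Rightarrow> nat \<Rightarrow> 'v" where
  "avg u n = (1 / 2) *\<^sub>R (u (Suc n) + u n)"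

definition Md :: "real \<Rightarrow> (nat \<Rightarrow> real) \<Rightarrow> (nat \<Rightarrow> real) \<Rightarrow> (nat \<Rightarrow> real) \<Rightarrow> nat \<Rightarrow> real^'n^'n" where
  "Md \<epsilon>0 \<epsilon>s \<epsilon>inf tr i = (tr i / (\<epsilon>0 * (\<epsilon>s i - \<epsilon>inf i))) *\<^sub>R mat 1"

definition Mp :: "real \<Rightarrow> (nat \<Rightarrow> real) \<Rightarrow> (nat \<Rightarrow> real) \<Rightarrow> nat \<Rightarrow> real^'n^'n" where
  "Mp \<epsilon>0 \<epsilon>s \<epsilon>inf i = (1 / (\<epsilon>0 * (\<epsilon>s i - \<epsilon>inf i))) *\<^sub>R mat 1"

definition difference_scheme ::
    "real \<Rightarrow> real \<Rightarrow> nat set \<Rightarrow> (nat \<Rightarrow> real) \<Rightarrow> (nat \<Rightarrow> real) \<Rightarrow> (nat \<Rightarrow> real) \<Rightarrow>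
     real^'m^'m \<Rightarrow> real^'n^'n \<Rightarrow> real^'n^'m \<Rightarrow> real^'m \<Rightarrow>
     (nat \<Rightarrow> real^'m) \<times> (nat \<Rightarrow> real^'n) \<times> (nat \<Rightarrow> real^'n) \<Rightarrow> bool" where
  "difference_scheme \<tau> \<epsilon>0 I \<epsilon>s \<epsilon>inf tr Mh Me C h_init = (\<lambda>(h, e, p).
     \<exists>pp :: nat \<Rightarrow> nat \<Rightarrow> real^'n.
       h 0 = h_init \<and> e 0 = 0 \<and> (\<forall>i\<in>I. pp i 0 = 0) \<and>
       (\<forall>n. Mh *v dtau \<tau> h n + C *v e n = 0) \<and>
       (\<forall>n. Me *v dtau \<tau> e n + (\<Sum>\<^sub>\<infinity>i\<in>I. dtau \<tau> (pp i) n) - transpose C *v h (Suc n) = 0) \<and>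
       (\<forall>n. \<forall>i\<in>I. Md \<epsilon>0 \<epsilon>s \<epsilon>inf tr i *v dtau \<tau> (pp i) n
                   + Mp \<epsilon>0 \<epsilon>s \<epsilon>inf i *v avg (pp i) n = avg e n) \<and>
       (\<forall>n. ((\<lambda>i. pp i n) has_sum p n) I))"

definition cq_scheme ::
    "real \<Rightarrow> (nat \<Rightarrow> real) \<Rightarrow>
     real^'m^'m \<Rightarrow> real^'n^'n \<Rightarrow> real^'n^'m \<Rightarrow> real^'m \<Rightarrow>
     (nat \<Rightarrow> real^'m) \<times> (nat \<Rightarrow> real^'n) \<times> (nat \<Rightarrow> real^'n) \<Rightarrow> bool" where
  "cq_scheme \<tau> \<omega> Mh Me C h_init = (\<lambda>(h, e, p).
       h 0 = h_init \<and> e 0 = 0 \<and>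
       (\<forall>n. Mh *v dtau \<tau> h n + C *v e n = 0) \<and>
       (\<forall>n. Me *v dtau \<tau> e n + dtau \<tau> p n - transpose C *v h (Suc n) = 0) \<and>
       (\<forall>n. p n = (\<Sum>k\<le>n. \<omega> (n - k) *\<^sub>R e k)))"

end

theory Submission
  imports Defs "HOL-Complex_Analysis.Laurent_Convergence"
begin

text \<open>
  Under \<open>s = 2 (1 - \<xi>) / (\<tau> (1 + \<xi>))\<close>, the symbol of the trapezoidal rule, a Debye pole becomes
  the rational function \<open>g (1 + \<xi>) / (1 - q \<xi>)\<close> with \<open>\<bar>q\<bar> < 1\<close>. Expanding it gives explicit
  weights (\<open>pole_weight\<close>), and these are also the impulse response of the trapezoidal
  discretization of that pole: solving \<open>p (n + 1) = q p n + g (e (n + 1) + e n)\<close> from rest turns the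
  polarization of the pole into the discrete convolution of its weights with the electric field
  (\<open>trapezoidal_recurrence_iff_convolution\<close>).

  It remains to add up the poles. The weights of pole \<open>i\<close> are bounded by twice its gain \<open>g i\<close>, and
  the gains are summable, so the sum over the poles may be exchanged with the power series on the
  unit disc; by uniqueness of power series, \<open>\<omega> n\<close> is the sum of the \<open>n\<close>-th weights of all poles
  (\<open>debye_weights_has_sum\<close>). Summing the convolutions over the poles then shows that a triple
  \<open>(h, e, p)\<close> satisfies the difference scheme exactly when it satisfies the convolution quadrature
  scheme (\<open>difference_scheme_iff_cq_scheme\<close>).

  Since the two schemes are the same condition, only the convolution quadrature scheme has to be
  shown uniquely solvable (\<open>cq_scheme_ex1\<close>). Each time step solves one linear system with \<open>Mh\<close> and
  one with \<open>Me + \<omega> 0 I\<close>; the latter matrix is positive definite because \<open>\<omega> 0\<close>, the sum of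
  the positive gains, is nonnegative.
\<close>

unbundle no fps_syntax

section \<open>Power series of a pole and of a sum of poles\<close>

text \<open>The Taylor coefficients at \<open>0\<close> of \<open>g (1 + \<xi>) / (1 - q \<xi>)\<close>.\<close>

definition pole_weight :: "real \<Rightarrow> real \<Rightarrow> nat \<Rightarrow> real" where
  "pole_weight g q n = (case n of 0 \<Rightarrow> g | Suc m \<Rightarrow> g * (q ^ Suc m + q ^ m))"

text \<open>
  A bound uniform in \<open>n\<close> and \<open>q\<close>: it makes the gains alone responsible for convergence of the sum
  over infinitely many poles, whose ratios may accumulate at \<open>-1\<close> or \<open>1\<close>.
\<close>

lemma abs_pole_weight_le:
  assumes "\<bar>q\<bar> \<le> 1"
  shows "\<bar>pole_weight g q n\<bar> \<le> 2 * \<bar>g\<bar>"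
proof (cases n)
  case 0
  then show ?thesis by (simp add: pole_weight_def)
next
  case (Suc m)
  have "\<bar>q ^ Suc m\<bar> \<le> 1" "\<bar>q ^ m\<bar> \<le> 1"
    using assms by (auto simp only: power_abs abs_ge_zero intro!: power_le_one)
  then have "\<bar>q ^ Suc m + q ^ m\<bar> \<le> 2" by linarith
  from mult_left_mono[OF this abs_ge_zero, of g] show ?thesis
    unfolding pole_weight_def Suc by (simp add: abs_mult mult.commute)
qed

lemma pole_weight_summable_on:
  assumes q: "\<And>i. i \<in> I \<Longrightarrow> \<bar>q i\<bar> \<le> 1" and g: "(\<lambda>i. \<bar>g i\<bar>) summable_on I"
  shows "(\<lambda>i. pole_weight (g i) (q i) n) summable_on I"
proof (rule abs_summable_summable[OF Infinite_Sum.abs_summable_on_comparison_test'])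
  show "(\<lambda>i. 2 * \<bar>g i\<bar>) summable_on I" by (intro summable_on_cmult_right g)
  show "norm (pole_weight (g i) (q i) n) \<le> 2 * \<bar>g i\<bar>" if "i \<in> I" for i
    using abs_pole_weight_le[OF q[OF that]] by simp
qed

lemma pole_weight_sums:
  fixes \<xi> :: complex
  assumes "\<bar>q\<bar> \<le> 1" and "norm \<xi> < 1"
  shows "(\<lambda>n. of_real (pole_weight g q n) * \<xi> ^ n) sums
           (of_real g * (1 + \<xi>) / (1 - of_real q * \<xi>))"
proof -
  let ?z = "of_real q * \<xi>"
  have "norm ?z \<le> norm \<xi>"
    using assms mult_right_mono[of "\<bar>q\<bar>" 1 "norm \<xi>"] by (simp add: norm_mult)
  then have geo: "(\<lambda>n. ?z ^ n) sums (1 / (1 - ?z))"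
    using assms by (intro geometric_sums) linarith
  have "(\<lambda>n. of_real g * ?z ^ n) sums (of_real g * (1 / (1 - ?z)))"
    by (rule sums_mult[OF geo])
  moreover have "(\<lambda>n. case n of 0 \<Rightarrow> 0 | Suc m \<Rightarrow> of_real g * \<xi> * ?z ^ m) sums
                   (of_real g * \<xi> * (1 / (1 - ?z)))"
    using sums_Suc[of "case_nat 0 (\<lambda>m. of_real g * \<xi> * ?z ^ m)"] sums_mult[OF geo, of "of_real g * \<xi>"]
    by simp
  ultimately have "(\<lambda>n. of_real g * ?z ^ n + (case n of 0 \<Rightarrow> 0 | Suc m \<Rightarrow> of_real g * \<xi> * ?z ^ m)) sums
                   (of_real g * (1 / (1 - ?z)) + of_real g * \<xi> * (1 / (1 - ?z)))"
    by (rule sums_add)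
  also have "(\<lambda>n. of_real g * ?z ^ n + (case n of 0 \<Rightarrow> 0 | Suc m \<Rightarrow> of_real g * \<xi> * ?z ^ m))
           = (\<lambda>n. of_real (pole_weight g q n) * \<xi> ^ n)"
    by (auto simp: fun_eq_iff pole_weight_def power_mult_distrib algebra_simps split: nat.split)
  also have "of_real g * (1 / (1 - ?z)) + of_real g * \<xi> * (1 / (1 - ?z))
           = of_real g * (1 + \<xi>) / (1 - ?z)"
    by (simp add: add_divide_distrib distrib_left)
  finally show ?thesis .
qed

text \<open>
  The double family over poles and powers is dominated by \<open>2 \<bar>g i\<bar> \<bar>\<xi>\<bar>\<^sup>n\<close>, which is summable on
  the product set, so its sum can be taken pole by pole or power by power.
\<close>

lemma infsum_pole_weight_sums:
  fixes \<xi> :: complex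
  assumes q: "\<And>i. i \<in> I \<Longrightarrow> \<bar>q i\<bar> \<le> 1" and g: "(\<lambda>i. \<bar>g i\<bar>) summable_on I" and \<xi>: "norm \<xi> < 1"
  shows "(\<lambda>n. of_real (\<Sum>\<^sub>\<infinity>i\<in>I. pole_weight (g i) (q i) n) * \<xi> ^ n) sums
           (\<Sum>\<^sub>\<infinity>i\<in>I. of_real (g i) * (1 + \<xi>) / (1 - of_real (q i) * \<xi>))"
proof -
  let ?v = "\<lambda>i n. pole_weight (g i) (q i) n"
  let ?f = "\<lambda>(i, n). of_real (?v i n) * \<xi> ^ n"
  have "(\<lambda>n. norm \<xi> ^ n) sums (1 / (1 - norm \<xi>))"
    using \<xi> by (intro geometric_sums) simp
  then have geo: "((\<lambda>n. norm \<xi> ^ n) has_sum (1 / (1 - norm \<xi>))) UNIV"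
    by (intro norm_summable_imp_has_sum) (use \<xi> in \<open>auto intro: summable_geometric\<close>)
  have "(\<lambda>(i, n). 2 * \<bar>g i\<bar> * norm \<xi> ^ n) summable_on I \<times> UNIV"
  proof (rule summable_on_SigmaI)
    show "((\<lambda>n. (\<lambda>(i, n). 2 * \<bar>g i\<bar> * norm \<xi> ^ n) (i, n)) has_sum
            (2 * \<bar>g i\<bar> * (1 / (1 - norm \<xi>)))) UNIV" for i
      using has_sum_cmult_right[OF geo, of "2 * \<bar>g i\<bar>"] by simp
    show "(\<lambda>i. 2 * \<bar>g i\<bar> * (1 / (1 - norm \<xi>))) summable_on I"
      by (intro summable_on_cmult_left summable_on_cmult_right g)
  qed auto
  then have "(\<lambda>x. norm (?f x)) summable_on I \<times> UNIV"
  proof (rule Infinite_Sum.abs_summable_on_comparison_test')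
    fix x assume "x \<in> I \<times> (UNIV :: nat set)"
    then show "norm (?f x) \<le> (\<lambda>(i, n). 2 * \<bar>g i\<bar> * norm \<xi> ^ n) x"
      using abs_pole_weight_le[OF q] by (auto simp: norm_mult norm_power intro!: mult_right_mono)
  qed
  then have summable: "?f summable_on I \<times> UNIV" by (rule abs_summable_summable)
  have rows: "((\<lambda>n. ?f (i, n)) has_sum (of_real (g i) * (1 + \<xi>) / (1 - of_real (q i) * \<xi>))) UNIV"
    if i: "i \<in> I" for i
  proof -
    have row: "(\<lambda>n. ?f (i, n)) summable_on UNIV"
      using summable_on_SigmaD1[of "\<lambda>i n. ?f (i, n)" I "\<lambda>_. UNIV" i] summable i by simp
    moreover have "(\<lambda>n. ?f (i, n)) sums (of_real (g i) * (1 + \<xi>) / (1 - of_real (q i) * \<xi>))"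
      using pole_weight_sums[OF q[OF i] \<xi>] by simp
    ultimately have "infsum (\<lambda>n. ?f (i, n)) UNIV = of_real (g i) * (1 + \<xi>) / (1 - of_real (q i) * \<xi>)"
      by (intro sums_unique2[OF has_sum_imp_sums]) (rule has_sum_infsum)
    then show ?thesis using has_sum_infsum[OF row] by simp
  qed
  obtain S where S: "(?f has_sum S) (I \<times> UNIV)" using summable by (auto simp: summable_on_def)
  have "S = (\<Sum>\<^sub>\<infinity>i\<in>I. of_real (g i) * (1 + \<xi>) / (1 - of_real (q i) * \<xi>))"
    using has_sum_SigmaD[OF S rows] by (simp add: infsumI)
  moreover have "((\<lambda>n. of_real (\<Sum>\<^sub>\<infinity>i\<in>I. ?v i n) * \<xi> ^ n) has_sum S) UNIV"
  proof (rule has_sum_SigmaD)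
    show "((\<lambda>(n, i). ?f (i, n)) has_sum S) (UNIV \<times> I)"
      using S by (subst (asm) has_sum_swap)
    show "((\<lambda>i. (\<lambda>(n, i). ?f (i, n)) (n, i)) has_sum of_real (\<Sum>\<^sub>\<infinity>i\<in>I. ?v i n) * \<xi> ^ n) I" for n
      using has_sum_cmult_left[OF has_sum_of_real[OF has_sum_infsum[OF pole_weight_summable_on[OF q g]]]] by simp
  qed
  ultimately show ?thesis using has_sum_imp_sums by auto
qed

section \<open>The trapezoidal recurrence as a convolution\<close>

text \<open>
  Multiplying the generating function \<open>g (1 + \<xi>) / (1 - q \<xi>)\<close> by \<open>1 - q \<xi>\<close> leaves \<open>g + g \<xi>\<close>; in terms of
  coefficients, consecutive weights differ from a geometric progression only at the first step.
  The convolution therefore obeys the recurrence, which determines \<open>p\<close> from \<open>p 0\<close>. The initial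
  value of the convolution is \<open>g e 0\<close>, so it starts from rest only because \<open>e 0 = 0\<close>.
\<close>

lemma trapezoidal_recurrence_iff_convolution:
  fixes e p :: "nat \<Rightarrow> 'v::real_vector"
  assumes e0: "e 0 = 0"
  shows "(p 0 = 0 \<and> (\<forall>n. p (Suc n) = q *\<^sub>R p n + g *\<^sub>R (e (Suc n) + e n))) \<longleftrightarrow>
         (\<forall>n. p n = (\<Sum>k\<le>n. pole_weight g q (n - k) *\<^sub>R e k))"
proof -
  let ?P = "\<lambda>n. \<Sum>k\<le>n. pole_weight g q (n - k) *\<^sub>R e k"
  have P0: "?P 0 = 0" by (simp add: e0)
  have step: "?P (Suc n) = q *\<^sub>R ?P n + g *\<^sub>R (e (Suc n) + e n)" for n
  proof -
    have diff: "pole_weight g q (Suc m) = q * pole_weight g q m + (if m = 0 then g else 0)" for m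
      by (cases m) (auto simp: pole_weight_def algebra_simps)
    have "?P (Suc n) = (\<Sum>k\<le>n. pole_weight g q (Suc (n - k)) *\<^sub>R e k) + g *\<^sub>R e (Suc n)"
      by (simp add: pole_weight_def[of _ _ 0] Suc_diff_le)
    also have "(\<Sum>k\<le>n. pole_weight g q (Suc (n - k)) *\<^sub>R e k)
             = q *\<^sub>R ?P n + (\<Sum>k\<le>n. if k = n then g *\<^sub>R e k else 0)"
      unfolding scaleR_sum_right sum.distrib[symmetric]
      by (intro sum.cong) (auto simp: diff algebra_simps)
    finally show ?thesis by (simp add: algebra_simps)
  qed
  show ?thesis
  proof
    assume *: "p 0 = 0 \<and> (\<forall>n. p (Suc n) = q *\<^sub>R p n + g *\<^sub>R (e (Suc n) + e n))"
    show "\<forall>n. p n = ?P n"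
    proof
      fix n show "p n = ?P n"
      proof (induction n)
        case 0 show ?case using * P0 by simp
      next
        case (Suc n) then show ?case using * step by metis
      qed
    qed
  next
    assume "\<forall>n. p n = ?P n"
    then show "p 0 = 0 \<and> (\<forall>n. p (Suc n) = q *\<^sub>R p n + g *\<^sub>R (e (Suc n) + e n))"
      using P0 step by metis
  qed
qed

section \<open>A Debye pole under the trapezoidal rule\<close>

text \<open>
  The parameters \<open>g\<close> and \<open>q\<close> of the pole \<open>\<alpha> / (1 + s t)\<close> for \<open>s = 2 (1 - \<xi>) / (\<tau> (1 + \<xi>))\<close>; the ratio
  is the amplification factor of the trapezoidal rule for \<open>t p' + p = 0\<close>.
\<close>

definition debye_gain :: "real \<Rightarrow> real \<Rightarrow> real \<Rightarrow> real" where
  "debye_gain \<tau> \<alpha> t = \<alpha> * \<tau> / (2 * t + \<tau>)"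

definition debye_ratio :: "real \<Rightarrow> real \<Rightarrow> real" where
  "debye_ratio \<tau> t = (2 * t - \<tau>) / (2 * t + \<tau>)"

lemma abs_debye_ratio_le: "\<tau> > 0 \<Longrightarrow> t > 0 \<Longrightarrow> \<bar>debye_ratio \<tau> t\<bar> \<le> 1"
  by (simp add: debye_ratio_def abs_le_iff field_simps)

lemma debye_gain_bounds:
  assumes "\<tau> > 0" "t > 0" "\<alpha> > 0"
  shows "0 < debye_gain \<tau> \<alpha> t" "debye_gain \<tau> \<alpha> t \<le> \<alpha>"
  using assms by (auto simp: debye_gain_def field_simps)

lemma debye_pole_bilinear:
  fixes \<xi> :: complex
  assumes "\<tau> > 0" "tr i > 0" "norm \<xi> < 1"
  shows "of_real \<epsilon>0 * debye_pole \<epsilon>s \<epsilon>inf tr i (2 * (1 - \<xi>) / (of_real \<tau> * (1 + \<xi>)))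
       = of_real (debye_gain \<tau> (\<epsilon>0 * (\<epsilon>s i - \<epsilon>inf i)) (tr i)) * (1 + \<xi>)
           / (1 - of_real (debye_ratio \<tau> (tr i)) * \<xi>)"
proof -
  let ?T = "of_real \<tau> :: complex" and ?t = "of_real (tr i) :: complex"
    and ?q = "of_real (debye_ratio \<tau> (tr i)) :: complex"
  have "1 + \<xi> \<noteq> 0" using assms(3) by (metis add_eq_0_iff norm_minus_cancel norm_one less_irrefl)
  moreover have "?T \<noteq> 0" using assms by simp
  moreover have sum0: "2 * ?t + ?T \<noteq> 0"
  proof -
    have "2 * ?t + ?T = of_real (2 * tr i + \<tau>)" by simp
    also have "\<dots> \<noteq> 0" using assms by (subst of_real_eq_0_iff) simp
    finally show ?thesis .
  qed
  moreover have q: "(2 * ?t + ?T) * (1 - ?q * \<xi>) = 2 * ?t * (1 - \<xi>) + ?T * (1 + \<xi>)"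
    using sum0 by (simp add: debye_ratio_def field_simps)
  moreover have "1 + 2 * (1 - \<xi>) / (?T * (1 + \<xi>)) * ?t = (2 * ?t + ?T) * (1 - ?q * \<xi>) / (?T * (1 + \<xi>))"
  proof -
    have "1 + a / d * t = (t * a + d) / d" if "d \<noteq> 0" for a d t :: complex
      using that by (simp add: field_simps)
    from this[of "?T * (1 + \<xi>)" "2 * (1 - \<xi>)" ?t] show ?thesis
      unfolding q using \<open>1 + \<xi> \<noteq> 0\<close> \<open>?T \<noteq> 0\<close> by (simp add: ac_simps)
  qed
  ultimately show ?thesis
    by (simp add: debye_pole_def debye_gain_def)
qed

text \<open>
  The power series with the summed weights and the one with coefficients \<open>\<omega> n\<close> represent the same
  function near \<open>0\<close>, hence agree term by term.
\<close>

lemma debye_weights_has_sum: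
  fixes \<omega> :: "nat \<Rightarrow> real"
  assumes \<tau>: "\<tau> > 0" and \<epsilon>0: "\<epsilon>0 > 0"
    and tr: "\<And>i. i \<in> I \<Longrightarrow> tr i > 0"
    and pos: "\<And>i. i \<in> I \<Longrightarrow> \<epsilon>s i - \<epsilon>inf i > 0"
    and summable: "(\<lambda>i. \<epsilon>s i - \<epsilon>inf i) summable_on I"
    and expansion: "(\<lambda>\<xi>. of_real \<epsilon>0 * debye_chi I \<epsilon>s \<epsilon>inf tr (2 * (1 - \<xi>) / (of_real \<tau> * (1 + \<xi>))))
           has_fps_expansion Abs_fps (\<lambda>n. complex_of_real (\<omega> n))"
  shows "((\<lambda>i. pole_weight (debye_gain \<tau> (\<epsilon>0 * (\<epsilon>s i - \<epsilon>inf i)) (tr i)) (debye_ratio \<tau> (tr i)) n)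
           has_sum \<omega> n) I"
proof -
  define g where "g i = debye_gain \<tau> (\<epsilon>0 * (\<epsilon>s i - \<epsilon>inf i)) (tr i)" for i
  define q where "q i = debye_ratio \<tau> (tr i)" for i
  have q: "\<bar>q i\<bar> \<le> 1" if "i \<in> I" for i
    using abs_debye_ratio_le \<tau> tr[OF that] by (simp add: q_def)
  have g: "(\<lambda>i. norm (g i)) summable_on I"
  proof (rule Infinite_Sum.abs_summable_on_comparison_test')
    show "(\<lambda>i. \<epsilon>0 * (\<epsilon>s i - \<epsilon>inf i)) summable_on I" by (intro summable_on_cmult_right summable)
    show "norm (g i) \<le> \<epsilon>0 * (\<epsilon>s i - \<epsilon>inf i)" if "i \<in> I" for i
      using debye_gain_bounds[OF \<tau> tr[OF that], of "\<epsilon>0 * (\<epsilon>s i - \<epsilon>inf i)"] \<epsilon>0 pos[OF that]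
      by (simp add: g_def)
  qed
  define W where "W n = (\<Sum>\<^sub>\<infinity>i\<in>I. pole_weight (g i) (q i) n)" for n
  have "(\<lambda>\<xi>. of_real \<epsilon>0 * debye_chi I \<epsilon>s \<epsilon>inf tr (2 * (1 - \<xi>) / (of_real \<tau> * (1 + \<xi>))))
          has_fps_expansion Abs_fps (\<lambda>n. complex_of_real (W n))"
  proof (rule has_fps_expansionI)
    have "\<forall>\<^sub>F \<xi> in nhds 0. \<xi> \<in> ball (0::complex) 1"
      by (intro eventually_nhds_in_open) auto
    then show "\<forall>\<^sub>F \<xi> in nhds 0. (\<lambda>n. fps_nth (Abs_fps (\<lambda>n. complex_of_real (W n))) n * \<xi> ^ n) sums
        (of_real \<epsilon>0 * debye_chi I \<epsilon>s \<epsilon>inf tr (2 * (1 - \<xi>) / (of_real \<tau> * (1 + \<xi>))))"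
    proof eventually_elim
      fix \<xi> :: complex assume "\<xi> \<in> ball 0 1"
      then have \<xi>: "norm \<xi> < 1" by simp
      have "of_real \<epsilon>0 * debye_chi I \<epsilon>s \<epsilon>inf tr (2 * (1 - \<xi>) / (of_real \<tau> * (1 + \<xi>)))
          = (\<Sum>\<^sub>\<infinity>i\<in>I. of_real \<epsilon>0 * debye_pole \<epsilon>s \<epsilon>inf tr i (2 * (1 - \<xi>) / (of_real \<tau> * (1 + \<xi>))))"
        unfolding debye_chi_def by (rule infsum_cmult_right'[symmetric])
      also have "\<dots> = (\<Sum>\<^sub>\<infinity>i\<in>I. of_real (g i) * (1 + \<xi>) / (1 - of_real (q i) * \<xi>))"
        unfolding g_def q_def by (intro infsum_cong debye_pole_bilinear \<tau> tr \<xi>)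
      finally show "(\<lambda>n. fps_nth (Abs_fps (\<lambda>n. complex_of_real (W n))) n * \<xi> ^ n) sums
          (of_real \<epsilon>0 * debye_chi I \<epsilon>s \<epsilon>inf tr (2 * (1 - \<xi>) / (of_real \<tau> * (1 + \<xi>))))"
        using infsum_pole_weight_sums[of I q g \<xi>] q g \<xi> by (simp add: W_def)
    qed
  qed
  from fps_expansion_unique_complex[OF this expansion] have "W n = \<omega> n"
    by (simp add: fps_eq_iff)
  moreover have "(\<lambda>i. pole_weight (g i) (q i) n) summable_on I"
    using g by (intro pole_weight_summable_on q) simp_all
  ultimately show ?thesis
    using has_sum_infsum unfolding W_def g_def q_def by fastforce
qed

text \<open>
  Clearing denominators in the discrete Debye equation and solving for the new polarization
  produces the same gain and ratio as the substitution in the transfer function.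
\<close>

lemma debye_step_iff:
  fixes e p :: "nat \<Rightarrow> real^'n"
  assumes "\<tau> > 0" "\<epsilon>0 > 0" "tr i > 0" "\<epsilon>s i - \<epsilon>inf i > 0"
  shows "Md \<epsilon>0 \<epsilon>s \<epsilon>inf tr i *v dtau \<tau> p n + Mp \<epsilon>0 \<epsilon>s \<epsilon>inf i *v avg p n = avg e n \<longleftrightarrow>
         p (Suc n) = debye_ratio \<tau> (tr i) *\<^sub>R p n
           + debye_gain \<tau> (\<epsilon>0 * (\<epsilon>s i - \<epsilon>inf i)) (tr i) *\<^sub>R (e (Suc n) + e n)"
proof -
  define \<alpha> where "\<alpha> = \<epsilon>0 * (\<epsilon>s i - \<epsilon>inf i)"
  have \<alpha>: "\<alpha> > 0" using assms by (simp add: \<alpha>_def)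
  let ?t = "tr i"
  have scalar: "?t / \<alpha> * ((x' - x) / \<tau>) + 1 / \<alpha> * ((x' + x) / 2) = (y' + y) / 2 \<longleftrightarrow>
         x' = debye_ratio \<tau> ?t * x + debye_gain \<tau> \<alpha> ?t * (y' + y)" for x x' y y'
  proof -
    have "?t / \<alpha> * ((x' - x) / \<tau>) + 1 / \<alpha> * ((x' + x) / 2) = (y' + y) / 2 \<longleftrightarrow>
          2 * ?t * (x' - x) + \<tau> * (x' + x) = \<alpha> * \<tau> * (y' + y)"
    proof -
      have "?t / \<alpha> * ((x' - x) / \<tau>) + 1 / \<alpha> * ((x' + x) / 2) - (y' + y) / 2
          = (2 * ?t * (x' - x) + \<tau> * (x' + x) - \<alpha> * \<tau> * (y' + y)) / (2 * \<alpha> * \<tau>)"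
        using \<alpha> assms(1) by (simp add: field_simps)
      moreover have "2 * \<alpha> * \<tau> \<noteq> 0" using \<alpha> assms(1) by simp
      ultimately show ?thesis by (metis divide_eq_0_iff eq_iff_diff_eq_0)
    qed
    also have "\<dots> \<longleftrightarrow> (2 * ?t + \<tau>) * x' = (2 * ?t - \<tau>) * x + \<alpha> * \<tau> * (y' + y)"
      by (auto simp: algebra_simps)
    also have "\<dots> \<longleftrightarrow> x' = ((2 * ?t - \<tau>) * x + \<alpha> * \<tau> * (y' + y)) / (2 * ?t + \<tau>)"
      using assms by (auto simp: nonzero_eq_divide_eq mult.commute)
    finally show ?thesis
      by (simp add: debye_ratio_def debye_gain_def add_divide_distrib)
  qed
  have "(Md \<epsilon>0 \<epsilon>s \<epsilon>inf tr i *v dtau \<tau> p n + Mp \<epsilon>0 \<epsilon>s \<epsilon>inf i *v avg p n) $ j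
      = ?t / \<alpha> * ((p (Suc n) $ j - p n $ j) / \<tau>) + 1 / \<alpha> * ((p (Suc n) $ j + p n $ j) / 2)" for j
    by (simp add: Md_def Mp_def dtau_def avg_def \<alpha>_def scaleR_matrix_vector_assoc[symmetric])
  moreover have "avg e n $ j = (e (Suc n) $ j + e n $ j) / 2" for j
    by (simp add: avg_def)
  ultimately show ?thesis
    unfolding vec_eq_iff \<alpha>_def[symmetric]
    by (simp only: scalar vector_add_component vector_scaleR_component real_scaleR_def)
qed

section \<open>Equivalence of the two schemes\<close>

lemma has_sum_finite_sum:
  fixes f :: "'k \<Rightarrow> 'i \<Rightarrow> 'v::topological_comm_monoid_add"
  assumes "finite K" and "\<And>k. k \<in> K \<Longrightarrow> (f k has_sum s k) I"
  shows "((\<lambda>i. \<Sum>k\<in>K. f k i) has_sum (\<Sum>k\<in>K. s k)) I"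
  using assms by (induction K rule: finite_induct) (auto intro: has_sum_add)

text \<open>
  In both directions the polarization of pole \<open>i\<close> is the convolution of its weights with \<open>e\<close>: the
  difference scheme forces this form, and for a solution of the convolution quadrature scheme it
  supplies the witness.
\<close>

lemma difference_scheme_iff_cq_scheme:
  fixes Mh :: "real^'m^'m" and Me :: "real^'n^'n" and C :: "real^'n^'m"
  assumes \<tau>: "\<tau> > 0" and \<epsilon>0: "\<epsilon>0 > 0"
    and tr: "\<And>i. i \<in> I \<Longrightarrow> tr i > 0"
    and pos: "\<And>i. i \<in> I \<Longrightarrow> \<epsilon>s i - \<epsilon>inf i > 0"
    and \<omega>: "\<And>n. ((\<lambda>i. pole_weight (debye_gain \<tau> (\<epsilon>0 * (\<epsilon>s i - \<epsilon>inf i)) (tr i))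
                                   (debye_ratio \<tau> (tr i)) n) has_sum \<omega> n) I"
  shows "difference_scheme \<tau> \<epsilon>0 I \<epsilon>s \<epsilon>inf tr Mh Me C h_init s \<longleftrightarrow> cq_scheme \<tau> \<omega> Mh Me C h_init s"
proof -
  obtain h e p where s: "s = (h, e, p)" by (cases s)
  let ?w = "\<lambda>i. pole_weight (debye_gain \<tau> (\<epsilon>0 * (\<epsilon>s i - \<epsilon>inf i)) (tr i)) (debye_ratio \<tau> (tr i))"
  let ?Q = "\<lambda>i n. \<Sum>k\<le>n. ?w i (n - k) *\<^sub>R e k"
  have pole: "(pp i 0 = 0 \<and> (\<forall>n. Md \<epsilon>0 \<epsilon>s \<epsilon>inf tr i *v dtau \<tau> (pp i) n
                   + Mp \<epsilon>0 \<epsilon>s \<epsilon>inf i *v avg (pp i) n = avg e n)) \<longleftrightarrow> (\<forall>n. pp i n = ?Q i n)"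
    if "i \<in> I" "e 0 = 0" for pp i
    unfolding debye_step_iff[of \<tau> \<epsilon>0 tr i \<epsilon>s \<epsilon>inf, OF \<tau> \<epsilon>0 tr[OF that(1)] pos[OF that(1)]]
    by (rule trapezoidal_recurrence_iff_convolution[of e, OF that(2)])
  have conv: "((\<lambda>i. ?Q i n) has_sum (\<Sum>k\<le>n. \<omega> (n - k) *\<^sub>R e k)) I" for n
    by (intro has_sum_finite_sum has_sum_bounded_linear[OF bounded_linear_scaleR_left \<omega>]) auto
  have dtau_sum: "(\<Sum>\<^sub>\<infinity>i\<in>I. dtau \<tau> (pp i) n) = dtau \<tau> p n"
    if "\<And>n. ((\<lambda>i. pp i n) has_sum p n) I" for pp :: "nat \<Rightarrow> nat \<Rightarrow> real^'n" and n
    unfolding dtau_def diff_conv_add_uminus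
    by (intro infsumI has_sum_scaleR has_sum_add that) (simp add: has_sum_uminus that)
  show ?thesis
  proof
    assume "difference_scheme \<tau> \<epsilon>0 I \<epsilon>s \<epsilon>inf tr Mh Me C h_init s"
    then obtain pp where h: "h 0 = h_init" "\<And>n. Mh *v dtau \<tau> h n + C *v e n = 0" and e: "e 0 = 0"
      and pp0: "\<And>i. i \<in> I \<Longrightarrow> pp i 0 = 0"
      and ampere: "\<And>n. Me *v dtau \<tau> e n + (\<Sum>\<^sub>\<infinity>i\<in>I. dtau \<tau> (pp i) n) - transpose C *v h (Suc n) = 0"
      and debye: "\<And>n i. i \<in> I \<Longrightarrow> Md \<epsilon>0 \<epsilon>s \<epsilon>inf tr i *v dtau \<tau> (pp i) n
                   + Mp \<epsilon>0 \<epsilon>s \<epsilon>inf i *v avg (pp i) n = avg e n"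
      and p: "\<And>n. ((\<lambda>i. pp i n) has_sum p n) I"
      unfolding difference_scheme_def s prod.case by blast
    have "pp i n = ?Q i n" if "i \<in> I" for i n
      using pole[OF that e, of pp] pp0 debye that by blast
    then have "((\<lambda>i. ?Q i n) has_sum p n) I" for n
      using p[of n] by (simp cong: has_sum_cong)
    then have "p n = (\<Sum>k\<le>n. \<omega> (n - k) *\<^sub>R e k)" for n
      using conv has_sum_unique by blast
    then show "cq_scheme \<tau> \<omega> Mh Me C h_init s"
      using h e ampere dtau_sum[OF p] unfolding cq_scheme_def s by simp
  next
    assume "cq_scheme \<tau> \<omega> Mh Me C h_init s"
    then have h: "h 0 = h_init" "\<And>n. Mh *v dtau \<tau> h n + C *v e n = 0" and e: "e 0 = 0"
      and ampere: "\<And>n. Me *v dtau \<tau> e n + dtau \<tau> p n - transpose C *v h (Suc n) = 0"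
      and p: "\<And>n. p n = (\<Sum>k\<le>n. \<omega> (n - k) *\<^sub>R e k)"
      unfolding cq_scheme_def s by auto
    have Q: "((\<lambda>i. ?Q i n) has_sum p n) I" for n using conv p by simp
    have "?Q i 0 = 0" "Md \<epsilon>0 \<epsilon>s \<epsilon>inf tr i *v dtau \<tau> (?Q i) n + Mp \<epsilon>0 \<epsilon>s \<epsilon>inf i *v avg (?Q i) n = avg e n"
      if "i \<in> I" for i n
      using pole[OF that e, of ?Q] by blast+
    then show "difference_scheme \<tau> \<epsilon>0 I \<epsilon>s \<epsilon>inf tr Mh Me C h_init s"
      using h e ampere dtau_sum[OF Q] Q unfolding difference_scheme_def s
      by (intro case_prodI exI[of _ ?Q]) simp
  qed
qed

section \<open>Unique solvability\<close>

text \<open>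
  The convolution makes each time step depend on the whole history of the electric field, so
  primitive recursion on the current state does not suffice. The solution is built as the diagonal
  of a sequence of functions, the \<open>n\<close>-th of which is correct up to index \<open>n\<close>.
\<close>

lemma causal_recursion_ex1:
  fixes F :: "nat \<Rightarrow> (nat \<Rightarrow> 'a) \<Rightarrow> 'a"
  assumes causal: "\<And>n x y. (\<And>k. k \<le> n \<Longrightarrow> x k = y k) \<Longrightarrow> F n x = F n y"
  shows "\<exists>!x. x 0 = a \<and> (\<forall>n. x (Suc n) = F n x)"
proof (rule ex_ex1I)
  define G where "G = rec_nat (\<lambda>_. a) (\<lambda>n x. x(Suc n := F n x))"
  have G: "G 0 = (\<lambda>_. a)" "G (Suc n) = (G n)(Suc n := F n (G n))" for n
    by (simp_all add: G_def)
  have stable: "G n k = G k k" if "k \<le> n" for n k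
    using that by (induction n rule: dec_induct) (auto simp: G)
  have "F n (G n) = F n (\<lambda>k. G k k)" for n
    by (rule causal) (rule stable)
  then show "\<exists>x. x 0 = a \<and> (\<forall>n. x (Suc n) = F n x)"
    by (intro exI[of _ "\<lambda>k. G k k"]) (simp add: G)
next
  fix x y assume x: "x 0 = a \<and> (\<forall>n. x (Suc n) = F n x)" and y: "y 0 = a \<and> (\<forall>n. y (Suc n) = F n y)"
  have "x n = y n" for n
  proof (induction n rule: less_induct)
    case (less n)
    show ?case
    proof (cases n)
      case 0 then show ?thesis using x y by simp
    next
      case (Suc m)
      then have "F m x = F m y" using less by (intro causal) simp
      then show ?thesis using x y Suc by simp
    qed
  qed
  then show "x = y" by blast
qed

lemma pos_def_matrix_inv:
  fixes A :: "real^'k^'k"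
  assumes "\<And>x. x \<noteq> 0 \<Longrightarrow> x \<bullet> (A *v x) > 0"
  shows "A *v x = y \<longleftrightarrow> x = matrix_inv A *v y"
proof -
  have "x = 0" if "A *v x = 0" for x using assms[of x] that by auto
  then obtain B where "B ** A = mat 1" using matrix_left_invertible_ker[of A] by blast
  then have "invertible A" using invertible_left_inverse by blast
  then have "A ** matrix_inv A = mat 1 \<and> matrix_inv A ** A = mat 1"
    unfolding invertible_def matrix_inv_def by (rule someI_ex)
  then show ?thesis by (metis matrix_vector_mul_assoc matrix_vector_mul_lid)
qed

text \<open>
  The convolution at level \<open>n + 1\<close> contains the unknown \<open>e (n + 1)\<close> with the factor \<open>\<omega> 0\<close>. Moving this
  term to the left adds \<open>\<omega> 0\<close> times the identity to \<open>Me\<close>, which keeps it positive definite, and what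
  remains is an explicit causal recursion for \<open>(h, e)\<close>.
\<close>

lemma cq_scheme_ex1:
  fixes Mh :: "real^'m^'m" and Me :: "real^'n^'n" and C :: "real^'n^'m"
  assumes \<tau>: "\<tau> > 0" and Mh: "sym_pos_def Mh" and Me: "sym_pos_def Me" and \<omega>0: "\<omega> 0 \<ge> 0"
  shows "\<exists>!s. cq_scheme \<tau> \<omega> Mh Me C h_init s"
proof -
  define A where "A = Me + \<omega> 0 *\<^sub>R mat 1"
  have A_mult: "A *v x = Me *v x + \<omega> 0 *\<^sub>R x" for x
    by (simp add: A_def matrix_vector_mult_add_rdistrib scaleR_matrix_vector_assoc[symmetric])
  have Mh_inv: "Mh *v x = y \<longleftrightarrow> x = matrix_inv Mh *v y" for x y
    using Mh by (intro pos_def_matrix_inv) (simp add: sym_pos_def_def)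
  have A_inv: "A *v x = y \<longleftrightarrow> x = matrix_inv A *v y" for x y
    using Me \<omega>0 by (intro pos_def_matrix_inv)
      (auto simp: A_mult sym_pos_def_def inner_add_right intro!: add_pos_nonneg)
  \<comment> \<open>the part of \<open>p (n + 1) - p n\<close> that is known once \<open>e 0, \<dots>, e n\<close> are\<close>
  define past where "past e n = (\<Sum>k\<le>n. \<omega> (Suc n - k) *\<^sub>R e k) - (\<Sum>k\<le>n. \<omega> (n - k) *\<^sub>R e k)"
    for e :: "nat \<Rightarrow> real^'n" and n
  define H where "H n x = fst (x n) - \<tau> *\<^sub>R (matrix_inv Mh *v (C *v snd (x n)))"
    for n and x :: "nat \<Rightarrow> (real^'m) \<times> (real^'n)"
  define E where "E n x = matrix_inv A *v
      (Me *v snd (x n) + \<tau> *\<^sub>R (transpose C *v H n x) - past (snd \<circ> x) n)"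
    for n and x :: "nat \<Rightarrow> (real^'m) \<times> (real^'n)"
  have scheme: "cq_scheme \<tau> \<omega> Mh Me C h_init (h, e, p) \<longleftrightarrow>
      p = (\<lambda>n. \<Sum>k\<le>n. \<omega> (n - k) *\<^sub>R e k) \<and> h 0 = h_init \<and> e 0 = 0 \<and>
      (\<forall>n. h (Suc n) = H n (\<lambda>k. (h k, e k)) \<and> e (Suc n) = E n (\<lambda>k. (h k, e k)))" for h e p
  proof -
    have faraday: "Mh *v dtau \<tau> h n + C *v e n = 0 \<longleftrightarrow> h (Suc n) = H n (\<lambda>k. (h k, e k))" for n
    proof -
      have "Mh *v dtau \<tau> h n + C *v e n = 0 \<longleftrightarrow> Mh *v dtau \<tau> h n = - (C *v e n)"
        by (rule eq_neg_iff_add_eq_0[symmetric])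
      also have "\<dots> \<longleftrightarrow> dtau \<tau> h n = - (matrix_inv Mh *v (C *v e n))"
        unfolding Mh_inv by (simp add: linear_neg[OF matrix_vector_mul_linear])
      also have "\<dots> \<longleftrightarrow> h (Suc n) - h n = \<tau> *\<^sub>R (- (matrix_inv Mh *v (C *v e n)))"
        using \<tau> by (simp add: dtau_def vector_fraction_eq_iff)
      finally show ?thesis by (auto simp: H_def algebra_simps)
    qed
    have ampere: "Me *v dtau \<tau> e n + dtau \<tau> p n - transpose C *v h (Suc n) = 0 \<longleftrightarrow>
        e (Suc n) = E n (\<lambda>k. (h k, e k))"
      if p: "p = (\<lambda>n. \<Sum>k\<le>n. \<omega> (n - k) *\<^sub>R e k)" and h: "h (Suc n) = H n (\<lambda>k. (h k, e k))" for n
    proof -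
      let ?c = "transpose C *v h (Suc n)"
      have dp: "p (Suc n) - p n = \<omega> 0 *\<^sub>R e (Suc n) + past e n"
        by (simp add: p past_def)
      have "Me *v dtau \<tau> e n + dtau \<tau> p n - ?c
          = (1 / \<tau>) *\<^sub>R (Me *v e (Suc n) - Me *v e n + (p (Suc n) - p n) - \<tau> *\<^sub>R ?c)"
        using \<tau> by (simp add: dtau_def matrix_vector_mult_scaleR matrix_vector_mult_diff_distrib
            scaleR_add_right scaleR_diff_right)
      also have "\<dots> = (1 / \<tau>) *\<^sub>R (A *v e (Suc n) - (Me *v e n + \<tau> *\<^sub>R ?c - past e n))"
        by (simp add: dp A_mult algebra_simps)
      finally have "Me *v dtau \<tau> e n + dtau \<tau> p n - ?c = 0 \<longleftrightarrow>
          A *v e (Suc n) = Me *v e n + \<tau> *\<^sub>R ?c - past e n"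
        using \<tau> by simp
      then show ?thesis unfolding A_inv by (simp add: E_def h o_def)
    qed
    show ?thesis unfolding cq_scheme_def using faraday ampere by (auto simp: fun_eq_iff)
  qed
  let ?rec = "\<lambda>x. x 0 = (h_init, 0) \<and> (\<forall>n. x (Suc n) = (H n x, E n x))"
  have "\<exists>!x. ?rec x"
  proof (rule causal_recursion_ex1)
    fix n and x y :: "nat \<Rightarrow> (real^'m) \<times> (real^'n)"
    assume agree: "\<And>k. k \<le> n \<Longrightarrow> x k = y k"
    have "past (snd \<circ> x) n = past (snd \<circ> y) n"
      unfolding past_def by (intro arg_cong2[where f = "(-)"] sum.cong) (auto simp: agree)
    then show "(H n x, E n x) = (H n y, E n y)"
      by (simp add: H_def E_def agree)
  qed
  then obtain x where x: "?rec x" and unique: "\<And>y. ?rec y \<Longrightarrow> y = x" by blast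
  show ?thesis
  proof (rule ex1I)
    let ?e = "snd \<circ> x"
    show "cq_scheme \<tau> \<omega> Mh Me C h_init (fst \<circ> x, ?e, \<lambda>n. \<Sum>k\<le>n. \<omega> (n - k) *\<^sub>R ?e k)"
      unfolding scheme using x by simp
  next
    fix s assume s: "cq_scheme \<tau> \<omega> Mh Me C h_init s"
    obtain h e p where hep: "s = (h, e, p)" by (cases s)
    have "(\<lambda>k. (h k, e k)) = x"
      using s unfolding hep scheme by (intro unique) simp
    then have "h = fst \<circ> x" "e = snd \<circ> x" by auto
    then show "s = (fst \<circ> x, snd \<circ> x, \<lambda>n. \<Sum>k\<le>n. \<omega> (n - k) *\<^sub>R (snd \<circ> x) k)"
      using s unfolding hep scheme by simp
  qed
qed

theorem lemma2:
  fixes \<tau> \<epsilon>0 :: real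
    and I :: "nat set"
    and \<epsilon>s \<epsilon>inf tr :: "nat \<Rightarrow> real"
    and \<omega> :: "nat \<Rightarrow> real"
    and Mh :: "real^'m^'m"
    and Me :: "real^'n^'n"
    and C :: "real^'n^'m"
    and h_init :: "real^'m"
  assumes "\<tau> > 0" and "\<epsilon>0 > 0"
    and "I \<subseteq> {1..}"
    and "\<And>i. i \<in> I \<Longrightarrow> tr i > 0"
    and "\<And>i. i \<in> I \<Longrightarrow> \<epsilon>s i - \<epsilon>inf i > 0"
    and "(\<lambda>i. \<epsilon>s i - \<epsilon>inf i) summable_on I"
    and "sym_pos_def Mh" and "sym_pos_def Me"
    and "(\<lambda>\<xi>. of_real \<epsilon>0 * debye_chi I \<epsilon>s \<epsilon>inf tr (2 * (1 - \<xi>) / (of_real \<tau> * (1 + \<xi>))))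
           has_fps_expansion Abs_fps (\<lambda>n. complex_of_real (\<omega> n))"
  shows "(\<exists>!s. difference_scheme \<tau> \<epsilon>0 I \<epsilon>s \<epsilon>inf tr Mh Me C h_init s) \<and>
         (\<exists>!s. cq_scheme \<tau> \<omega> Mh Me C h_init s) \<and>
         (\<forall>s s'. difference_scheme \<tau> \<epsilon>0 I \<epsilon>s \<epsilon>inf tr Mh Me C h_init s \<longrightarrow>
                 cq_scheme \<tau> \<omega> Mh Me C h_init s' \<longrightarrow> s = s')"
proof -
  have weights: "((\<lambda>i. pole_weight (debye_gain \<tau> (\<epsilon>0 * (\<epsilon>s i - \<epsilon>inf i)) (tr i))
                          (debye_ratio \<tau> (tr i)) n) has_sum \<omega> n) I" for n
    by (rule debye_weights_has_sum[OF assms(1,2,4,5,6,9)])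
  have "difference_scheme \<tau> \<epsilon>0 I \<epsilon>s \<epsilon>inf tr Mh Me C h_init = cq_scheme \<tau> \<omega> Mh Me C h_init"
    by (intro ext difference_scheme_iff_cq_scheme[OF assms(1,2,4,5) weights])
  moreover have "\<omega> 0 \<ge> 0"
  proof (rule has_sum_nonneg[OF weights])
    fix i assume "i \<in> I"
    then show "0 \<le> pole_weight (debye_gain \<tau> (\<epsilon>0 * (\<epsilon>s i - \<epsilon>inf i)) (tr i)) (debye_ratio \<tau> (tr i)) 0"
      using debye_gain_bounds(1)[of \<tau> "tr i" "\<epsilon>0 * (\<epsilon>s i - \<epsilon>inf i)"] assms(1,2,4,5)
      by (simp add: pole_weight_def less_imp_le)
  qed
  then have "\<exists>!s. cq_scheme \<tau> \<omega> Mh Me C h_init s"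
    by (rule cq_scheme_ex1[OF assms(1,7,8)])
  ultimately show ?thesis by auto
qed

end
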